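(* Let $\mathrm{S}\in\{\mathbb{N},\mathbb{R}\}$, $p\in\mathbb{N}$ and $g\in\mathcal{D}^p_{\mathrm{S}}$. Suppose that $f\colon\mathbb{R}_+\to\mathbb{R}$ is a solution to the equation $\Delta f=g$ that lies in $\mathcal{K}^p$. Then the following assertions hold. (a) $f\in\mathcal{R}^{p+1}_{\mathrm{S}}$. (b) For each $x>0$, the sequence $n\mapsto f^p_n[g](x)$ converges and $$f(x)=f(1)+\lim_{n\to\infty}f^p_n[g](x).$$ (c) The sequence $n\mapsto f^p_n[g]$ converges uniformly on any bounded subset of $\mathbb{R}_+$ to $f-f(1)$.
   Context: $\mathbb{N}=\{0,1,2,\ldots\}$, $\mathbb{N}^*=\{1,2,\ldots\}$, $\mathbb{R}_+=(0,\infty)$, and $\Delta f(x)=f(x+1)-f(x)$. For $\mathrm{S}\in\{\mathbb{N},\mathbb{R}\}$, $x\to_{\mathrm{S}}\infty$ means that $x$ tends to $+\infty$ taking values only in $\mathrm{S}$. For an integer $p\ge -1$, a function $f\colon I\to\mathbb{R}$ on a real interval $I$ is $p$-convex (resp. $p$-concave) if for all $x_0<\cdots<x_{p+1}$ in $I$ the divided difference $f[x_0,\ldots,x_{p+1}]$ is $\ge 0$ (resp. $\le 0$), where $f[x_0,\ldots,x_n]=\sum_{k=0}^n f(x_k)/\prod_{j\ne k}(x_k-x_j)$. $\mathcal{K}^p$ is the set of functions $\mathbb{R}_+\to\mathbb{R}$ that are $p$-convex on some $[a,\infty)$ or $p$-concave on some $[a,\infty)$. $\mathcal{D}^p_{\mathrm{S}}$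 is the set of $g\colon\mathbb{R}_+\to\mathbb{R}$ with $\Delta^pg(x)\to 0$ as $x\to_{\mathrm{S}}\infty$. For $a>0$, $\rho^p_a[g](x)=g(x+a)-\sum_{j=0}^{p-1}\binom{x}{j}\Delta^jg(a)$ for $x\ge 0$. $\mathcal{R}^p_{\mathrm{S}}$ is the set of $g\colon\mathbb{R}_+\to\mathbb{R}$ such that, for each $x>0$, $\rho^p_a[g](x)\to 0$ as $a\to_{\mathrm{S}}\infty$. For $n\in\mathbb{N}^*$, $$f^p_n[g](x)=-g(x)+\sum_{k=1}^{n-1}(g(k)-g(x+k))+\sum_{j=1}^p\binom{x}{j}\Delta^{j-1}g(n),\qquad x>0.$$ *)

theory Defs
  imports "HOL-Analysis.Analysis"
begin

text \<open>
  A function from the positive reals to the reals is represented by a total function on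
  the type of reals of which only the values on \<open>{0<..}\<close> are ever used.
\<close>

definition at_top_in :: "real set \<Rightarrow> real filter" where
  "at_top_in S = inf at_top (principal S)"

definition fwd_diff :: "(real \<Rightarrow> real) \<Rightarrow> real \<Rightarrow> real" where
  "fwd_diff f x = f (x + 1) - f x"

text \<open>The divided difference of \<open>f\<close> at the \<open>n + 1\<close> points \<open>x 0, \<dots>, x n\<close>.\<close>

definition divided_diff :: "(real \<Rightarrow> real) \<Rightarrow> (nat \<Rightarrow> real) \<Rightarrow> nat \<Rightarrow> real" where
  "divided_diff f x n = (\<Sum>k\<le>n. f (x k) / (\<Prod>j\<in>{..n} - {k}. x k - x j))"

text \<open>The order \<open>p\<close> in the next three definitions is meant to satisfy \<open>p \<ge> -1\<close>.\<close>

definition p_convex_on :: "int \<Rightarrow> real set \<Rightarrow> (real \<Rightarrow> real) \<Rightarrow> bool" where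
  "p_convex_on p I f \<longleftrightarrow>
     (\<forall>x. strict_mono_on {..nat (p + 1)} x \<and> x ` {..nat (p + 1)} \<subseteq> I \<longrightarrow>
          divided_diff f x (nat (p + 1)) \<ge> 0)"

definition p_concave_on :: "int \<Rightarrow> real set \<Rightarrow> (real \<Rightarrow> real) \<Rightarrow> bool" where
  "p_concave_on p I f \<longleftrightarrow>
     (\<forall>x. strict_mono_on {..nat (p + 1)} x \<and> x ` {..nat (p + 1)} \<subseteq> I \<longrightarrow>
          divided_diff f x (nat (p + 1)) \<le> 0)"

definition K_class :: "int \<Rightarrow> (real \<Rightarrow> real) set" where
  "K_class p = {f. \<exists>a>0. p_convex_on p {a..} f \<or> p_concave_on p {a..} f}"

definition D_class :: "nat \<Rightarrow> real set \<Rightarrow> (real \<Rightarrow> real) set" where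
  "D_class p S = {g. ((fwd_diff ^^ p) g \<longlongrightarrow> 0) (at_top_in S)}"

definition rho :: "nat \<Rightarrow> real \<Rightarrow> (real \<Rightarrow> real) \<Rightarrow> real \<Rightarrow> real" where
  "rho p a g x = g (x + a) - (\<Sum>j<p. (x gchoose j) * (fwd_diff ^^ j) g a)"

definition R_class :: "nat \<Rightarrow> real set \<Rightarrow> (real \<Rightarrow> real) set" where
  "R_class p S = {g. \<forall>x>0. ((\<lambda>a. rho p a g x) \<longlongrightarrow> 0) (at_top_in S)}"

text \<open>Only the terms with \<open>n \<ge> 1\<close> are meaningful; the value at \<open>n = 0\<close> is irrelevant for limits.\<close>

definition f_seq :: "nat \<Rightarrow> nat \<Rightarrow> (real \<Rightarrow> real) \<Rightarrow> real \<Rightarrow> real" where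
  "f_seq p n g x =
     - g x + (\<Sum>k=1..<n. g (real k) - g (x + real k))
     + (\<Sum>j=1..p. (x gchoose j) * (fwd_diff ^^ (j - 1)) g (real n))"

end

theory Submission
  imports Defs
begin

text \<open>
  Write \<open>\<Delta>\<close> for the forward difference. By telescoping, \<open>f_seq p n g x\<close> equals
  \<open>f x - f 1 - rho (p + 1) n f x\<close> (lemma \<open>f_seq_eq_rho\<close>), so all three assertions say that the
  remainder \<open>rho (p + 1) a f x\<close> tends to zero, in (c) uniformly for bounded \<open>x\<close>.

  This remainder is the error of Newton's interpolation of \<open>f\<close> at the nodes \<open>a, \<dots>, a + p\<close>,
  evaluated at \<open>a + x\<close>. It vanishes if \<open>a + x\<close> is a node; otherwise it is the product of
  \<open>x, x - 1, \<dots>, x - p\<close> with the divided difference of \<open>f\<close> at \<open>a, \<dots>, a + p, a + x\<close> (lemma \<open>rho_eq_dd\<close>). If \<open>f\<close> is \<open>p\<close>-convex, that divided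
  difference is nonnegative. Multiplied by \<open>x\<close>, it becomes the difference of two divided
  differences on \<open>p + 1\<close> points, at \<open>a + 1, \<dots>, a + p, a + x\<close> and at \<open>a, \<dots>, a + p\<close>. Divided
  differences of a \<open>p\<close>-convex function on \<open>p + 1\<close> points increase when the points move to the
  right, so for an integer \<open>N\<close> beyond \<open>x\<close> and \<open>p\<close> the first one is at most the divided
  difference at \<open>a + N, \<dots>, a + N + p\<close>. The remainder is thus controlled by
  \<open>\<Delta>\<^sup>p f (a + N) - \<Delta>\<^sup>p f a\<close>, uniformly for \<open>0 < x < N\<close> (lemma \<open>rho_bound\<close>).
  Since \<open>N\<close> is an integer, this is the sum of the \<open>N\<close> terms \<open>\<Delta>\<^sup>p g (a + k)\<close> with \<open>k < N\<close>, and each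
  of them tends to zero by hypothesis.
\<close>

section \<open>Divided differences over finite sets\<close>

text \<open>
  Divided differences are symmetric in their nodes. Indexing them by sets lets nodes be
  added and exchanged without keeping them sorted.
\<close>

definition dd :: "(real \<Rightarrow> real) \<Rightarrow> real set \<Rightarrow> real" where
  "dd f A = (\<Sum>c\<in>A. f c / (\<Prod>d\<in>A - {c}. c - d))"

lemma dd_insert:
  assumes "finite C" "a \<notin> C"
  shows "dd f (insert a C) =
    f a / (\<Prod>d\<in>C. a - d) + (\<Sum>c\<in>C. f c / ((c - a) * (\<Prod>d\<in>C - {c}. c - d)))"
proof -
  have "(\<Prod>d\<in>insert a C - {c}. c - d) = (c - a) * (\<Prod>d\<in>C - {c}. c - d)" if "c \<in> C" for c
  proof -
    have "insert a C - {c} = insert a (C - {c})" using assms that by auto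
    then show ?thesis using assms by simp
  qed
  moreover have "insert a C - {a} = C" using assms by auto
  ultimately show ?thesis
    using assms unfolding dd_def by simp
qed

text \<open>
  At a node \<open>c\<close> in \<open>C\<close>, the weights of the three divided differences are related by the partial
  fraction decomposition \<open>(b - a) / ((c - a) (c - b)) = 1 / (c - b) - 1 / (c - a)\<close>.
\<close>

lemma dd_recursion:
  assumes C: "finite C" and a: "a \<notin> C" and b: "b \<notin> C" and ab: "a \<noteq> b"
  shows "(b - a) * dd f (insert a (insert b C)) = dd f (insert b C) - dd f (insert a C)"
proof -
  let ?w = "\<lambda>c. \<Prod>d\<in>C - {c}. c - d"
  have split_a: "dd f (insert a (insert b C)) =
      f a / ((a - b) * (\<Prod>d\<in>C. a - d)) + (f b / ((b - a) * (\<Prod>d\<in>C. b - d))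
        + (\<Sum>c\<in>C. f c / ((c - a) * ((c - b) * ?w c))))"
  proof -
    have "(\<Prod>d\<in>insert b C - {c}. c - d) = (c - b) * ?w c" if "c \<in> C" for c
    proof -
      have "insert b C - {c} = insert b (C - {c})" using b that by auto
      then show ?thesis using C b by simp
    qed
    moreover have "insert b C - {b} = C" using b by auto
    ultimately show ?thesis
      using assms by (subst dd_insert) auto
  qed
  have partial_fractions: "(b - a) * (f c / ((c - a) * ((c - b) * ?w c)))
      = f c / ((c - b) * ?w c) - f c / ((c - a) * ?w c)" if "c \<in> C" for c
  proof -
    have "c \<noteq> a" "c \<noteq> b" using that a b by auto
    moreover have "?w c \<noteq> 0" using C by auto
    ultimately show ?thesis by (simp add: divide_simps) (simp add: algebra_simps)
  qed
  have "(b - a) * (f a / ((a - b) * (\<Prod>d\<in>C. a - d))) = - (f a / (\<Prod>d\<in>C. a - d))"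
  proof -
    have "(\<Prod>d\<in>C. a - d) \<noteq> 0" using C a by auto
    then show ?thesis using ab by (simp add: divide_simps) (simp add: algebra_simps)
  qed
  moreover have "(b - a) * (f b / ((b - a) * (\<Prod>d\<in>C. b - d))) = f b / (\<Prod>d\<in>C. b - d)"
    using ab by simp
  moreover have "(b - a) * (\<Sum>c\<in>C. f c / ((c - a) * ((c - b) * ?w c)))
      = (\<Sum>c\<in>C. f c / ((c - b) * ?w c)) - (\<Sum>c\<in>C. f c / ((c - a) * ?w c))"
    using partial_fractions by (simp add: sum_distrib_left sum_subtractf)
  ultimately show ?thesis
    unfolding split_a dd_insert[OF C a] dd_insert[OF C b] by (simp only: distrib_left)
qed

lemma divided_diff_eq_dd:
  assumes "inj_on x {..n}"
  shows "divided_diff f x n = dd f (x ` {..n})"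
proof -
  have "(\<Prod>d\<in>x ` {..n} - {x k}. x k - d) = (\<Prod>j\<in>{..n} - {k}. x k - x j)" if "k \<le> n" for k
  proof -
    have "x ` {..n} - {x k} = x ` ({..n} - {k})"
      using assms that by (auto simp: inj_on_def)
    moreover have "inj_on x ({..n} - {k})" using assms by (rule inj_on_subset) auto
    ultimately show ?thesis by (simp add: prod.reindex)
  qed
  then show ?thesis
    using assms unfolding divided_diff_def dd_def by (simp add: sum.reindex)
qed

lemma strict_mono_enumeration:
  fixes A :: "real set"
  assumes "finite A" "card A = Suc n"
  obtains x where "strict_mono_on {..n} x" "x ` {..n} = A"
proof
  let ?l = "sorted_list_of_set A"
  have len: "length ?l = Suc n" using assms by simp
  show "strict_mono_on {..n} (\<lambda>i. ?l ! i)"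
    using len sorted_wrt_nth_less[OF strict_sorted_list_of_set[of A]]
    by (auto simp: strict_mono_on_def)
  have "(\<lambda>i. ?l ! i) ` {..n} = set ?l"
    using len by (auto simp: in_set_conv_nth less_Suc_eq_le image_iff)
  then show "(\<lambda>i. ?l ! i) ` {..n} = A" using assms by simp
qed

lemma p_convex_on_dd_nonneg:
  assumes f: "p_convex_on (int p) I f" and A: "finite A" "card A = p + 2" "A \<subseteq> I"
  shows "0 \<le> dd f A"
proof -
  obtain x where x: "strict_mono_on {..Suc p} x" "x ` {..Suc p} = A"
    using strict_mono_enumeration[of A "Suc p"] A by auto
  have "nat (int p + 1) = Suc p" by simp
  then have "0 \<le> divided_diff f x (Suc p)"
    using f x A unfolding p_convex_on_def by simp
  then show ?thesis
    using x divided_diff_eq_dd strict_mono_on_imp_inj_on by metis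
qed

text \<open>
  By \<open>dd_recursion\<close>, moving one node to the right does not decrease the divided difference.
  The nodes in \<open>A\<close> are replaced by those in \<open>B\<close> one after another. The common part \<open>C\<close> is there
  for the induction, where it collects the nodes that have already been moved. Since \<open>B\<close> lies
  strictly to the right of \<open>A\<close>, no two nodes ever collide.
\<close>

lemma dd_mono:
  assumes f: "p_convex_on (int p) I f"
    and "finite A" "finite B" "finite C" "card A = card B" "card A + card C = Suc p"
    and "A \<union> B \<union> C \<subseteq> I" "A \<inter> C = {}" "B \<inter> C = {}" "\<And>a b. a \<in> A \<Longrightarrow> b \<in> B \<Longrightarrow> a < b"
  shows "dd f (A \<union> C) \<le> dd f (B \<union> C)"
  using assms(2-)
proof (induction A arbitrary: B C rule: finite_induct)
  case empty
  then show ?case by simp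
next
  case (insert a A)
  obtain b B' where B: "B = insert b B'" "b \<notin> B'"
  proof -
    have "B \<noteq> {}" using insert.hyps insert.prems(3) by auto
    then show ?thesis using that by (meson ex_in_conv mk_disjoint_insert)
  qed
  have fin: "finite (A \<union> C)" "finite B'" using insert.hyps(1) insert.prems(1,2) B by auto
  have ab: "a < b" using insert.prems(8) B by simp
  have new: "a \<notin> A \<union> C" "b \<notin> A \<union> C"
    using insert.hyps(2) insert.prems(6,7) insert.prems(8)[of b b] B by auto
  have cards: "card A = card B'" "card A + card C = p"
    using insert.hyps insert.prems(3,4) B fin by auto
  have "card (A \<union> C) = p"
    using insert.hyps(1) insert.prems(2,6) cards by (subst card_Un_disjoint) auto
  then have "card (insert a (insert b (A \<union> C))) = p + 2"
    using new fin ab by simp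
  then have "0 \<le> dd f (insert a (insert b (A \<union> C)))"
    using insert.prems(5) B fin by (intro p_convex_on_dd_nonneg[OF f]) auto
  then have "0 \<le> (b - a) * dd f (insert a (insert b (A \<union> C)))"
    using ab by simp
  also have "\<dots> = dd f (insert b (A \<union> C)) - dd f (insert a (A \<union> C))"
    using fin(1) new ab by (intro dd_recursion) auto
  finally have "dd f (insert a (A \<union> C)) \<le> dd f (insert b (A \<union> C))"
    by simp
  \<comment> \<open>The node \<open>b\<close> has taken the place of \<open>a\<close> and now belongs to the common part.\<close>
  moreover have "dd f (A \<union> insert b C) \<le> dd f (B' \<union> insert b C)"
  proof (rule insert.IH)
    show "card A + card (insert b C) = Suc p"
      using cards new insert.prems(2) by simp
    show "A \<union> B' \<union> insert b C \<subseteq> I" "finite (insert b C)"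
      using insert.prems(2,5) B by auto
    show "A \<inter> insert b C = {}" "B' \<inter> insert b C = {}"
      using insert.prems(6,7) B new by auto
    show "c < d" if "c \<in> A" "d \<in> B'" for c d
      using insert.prems(8) B that by simp
  qed (use fin cards in simp_all)
  ultimately show ?case using B by simp
qed

section \<open>Newton interpolation at equidistant nodes\<close>

definition nodes :: "real \<Rightarrow> nat \<Rightarrow> real set" where
  "nodes a n = (\<lambda>i. a + real i) ` {..<n}"

lemma finite_nodes [simp]: "finite (nodes a n)"
  by (simp add: nodes_def)

lemma card_nodes [simp]: "card (nodes a n) = n"
  by (simp add: nodes_def card_image inj_on_def)

lemma nodes_subset: "nodes a n \<subseteq> {a..<a + real n}"
  by (auto simp: nodes_def)

lemma nodes_Suc: "nodes a (Suc n) = insert (a + real n) (nodes a n)"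
  by (simp add: nodes_def lessThan_Suc)

lemma nodes_Suc_shift: "nodes a (Suc n) = insert a (nodes (a + 1) n)"
  by (simp add: nodes_def lessThan_Suc_eq_insert_0 image_image add.assoc)

lemma fwd_diff_pow_Suc: "(fwd_diff ^^ Suc n) f a = (fwd_diff ^^ n) f (a + 1) - (fwd_diff ^^ n) f a"
  unfolding funpow.simps(2) o_apply by (rule fwd_diff_def)

lemma dd_nodes: "dd f (nodes a (Suc p)) = (fwd_diff ^^ p) f a / fact p"
proof (induction p arbitrary: a)
  case 0
  have "nodes a (Suc 0) = {a}" by (simp add: nodes_def lessThan_Suc)
  then show ?case by (simp add: dd_def)
next
  case (Suc p)
  let ?C = "nodes (a + 1) p" and ?b = "a + 1 + real p"
  have "a \<notin> ?C" "?b \<notin> ?C" "a \<noteq> ?b" by (auto simp: nodes_def)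
  from dd_recursion[OF finite_nodes this, of f]
  have "(1 + real p) * dd f (nodes a (Suc (Suc p)))
      = dd f (nodes (a + 1) (Suc p)) - dd f (nodes a (Suc p))"
    by (simp add: nodes_Suc_shift[of a] nodes_Suc[of "a + 1"])
  also have "\<dots> = (fwd_diff ^^ Suc p) f a / fact p"
    by (simp only: Suc.IH fwd_diff_pow_Suc diff_divide_distrib)
  finally show ?case by (simp add: divide_simps) (simp add: algebra_simps)
qed

lemma rho_Suc: "rho (Suc p) a f x = rho p a f x - (x gchoose p) * (fwd_diff ^^ p) f a"
  by (simp add: rho_def)

text \<open>
  The error formula of Newton interpolation at \<open>a, \<dots>, a + p - 1\<close>. Passing from \<open>p\<close> to \<open>p + 1\<close>
  subtracts the next Newton term on the left-hand side; on the right-hand side it is one use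
  of \<open>dd_recursion\<close>, exchanging the new node \<open>a + p\<close> and the evaluation point.
\<close>

lemma rho_eq_dd:
  assumes "a + x \<notin> nodes a p"
  shows "rho p a f x = (\<Prod>i<p. x - real i) * dd f (insert (a + x) (nodes a p))"
  using assms
proof (induction p)
  case 0
  then show ?case by (simp add: nodes_def rho_def dd_def add.commute)
next
  case (Suc p)
  let ?C = "nodes a p"
  have new: "a + real p \<notin> ?C" "a + x \<notin> ?C" "a + real p \<noteq> a + x"
    using Suc.prems by (auto simp: nodes_Suc) (auto simp: nodes_def)
  from dd_recursion[OF finite_nodes this, of f]
  have rec: "dd f (insert (a + x) ?C) = (x - real p) * dd f (insert (a + x) (nodes a (Suc p)))
      + (fwd_diff ^^ p) f a / fact p"
    by (simp add: dd_nodes[symmetric] nodes_Suc insert_commute)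
  have "(x gchoose p) = (\<Prod>i<p. x - real i) / fact p"
    by (simp add: gbinomial_prod_rev atLeast0LessThan)
  then show ?case
    using Suc.IH new(2) by (simp add: rho_Suc rec algebra_simps)
qed

text \<open>Interpolation is exact at the nodes: the first \<open>m + 1\<close> terms of Newton's formula already
  reproduce the value at the node with index \<open>m\<close>, and later binomial coefficients vanish.\<close>

lemma rho_at_node:
  assumes "m < p"
  shows "rho p a f (real m) = 0"
  using assms
proof (induction p)
  case 0
  then show ?case by simp
next
  case (Suc p)
  show ?case
  proof (cases "m = p")
    case True
    have "a + real p \<notin> nodes a p" by (auto simp: nodes_def)
    moreover have "(real p gchoose p) = (\<Prod>i<p. real p - real i) / fact p"
      by (simp add: gbinomial_prod_rev atLeast0LessThan)
    ultimately show ?thesis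
      using True by (simp add: rho_Suc rho_eq_dd nodes_Suc[symmetric] dd_nodes)
  next
    case False
    then have "(real m gchoose p) = 0"
      using Suc.prems by (simp add: binomial_gbinomial[symmetric])
    then show ?thesis using False Suc by (simp add: rho_Suc)
  qed
qed

section \<open>Bounding the remainder of a convex or concave function\<close>

text \<open>
  The factor \<open>x\<close> of the product in \<open>rho_eq_dd\<close> is kept with the divided difference, because
  \<open>dd_recursion\<close> turns that product into a difference of divided differences on \<open>p + 1\<close> points,
  to which \<open>dd_mono\<close> applies. The other \<open>p\<close> factors are each at most \<open>N\<close> in absolute value.
\<close>

lemma rho_bound_convex:
  assumes f: "p_convex_on (int p) {A..} f" and a: "A \<le> a"
    and x: "0 < x" "x < real N" and N: "p < N"
  shows "\<bar>rho (Suc p) a f x\<bar> \<le> real N ^ p * ((fwd_diff ^^ p) f (a + real N) - (fwd_diff ^^ p) f a)"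
proof -
  let ?d = "(fwd_diff ^^ p) f (a + real N) - (fwd_diff ^^ p) f a"
  \<comment> \<open>The nodes \<open>a + N, \<dots>, a + N + p\<close> lie strictly to the right of all points considered here,
    as \<open>dd_mono\<close> requires.\<close>
  have upper: "dd f X \<le> (fwd_diff ^^ p) f (a + real N) / fact p"
    if "finite X" "card X = Suc p" "X \<subseteq> {a..<a + real N}" for X
  proof -
    have right: "a + real N \<le> b" if "b \<in> nodes (a + real N) (Suc p)" for b
      using that nodes_subset by fastforce
    have "dd f (X \<union> {}) \<le> dd f (nodes (a + real N) (Suc p) \<union> {})"
    proof (rule dd_mono[OF f])
      show "X \<union> nodes (a + real N) (Suc p) \<union> {} \<subseteq> {A..}"
        using that a right by fastforce
      show "c < b" if "c \<in> X" "b \<in> nodes (a + real N) (Suc p)" for c b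
        using that right[of b] \<open>X \<subseteq> {a..<a + real N}\<close> by force
    qed (use that in auto)
    then show ?thesis by (simp add: dd_nodes)
  qed
  have left_nodes: "nodes a (Suc p) \<subseteq> {a..<a + real N}"
    using N nodes_subset[of a "Suc p"] by force
  have d_fact: "0 \<le> ?d / fact p"
    using upper[of "nodes a (Suc p)"] left_nodes by (simp add: dd_nodes diff_divide_distrib)
  then have d: "0 \<le> ?d" by (simp add: pos_le_divide_eq)
  show ?thesis
  proof (cases "a + x \<in> nodes a (Suc p)")
    case True
    then obtain m where "m < Suc p" "x = real m" by (auto simp: nodes_def)
    then show ?thesis using d by (simp add: rho_at_node)
  next
    case False
    let ?D = "dd f (insert (a + x) (nodes a (Suc p)))"
    let ?C = "nodes (a + 1) p"
    have D: "0 \<le> ?D"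
      using False a x left_nodes by (intro p_convex_on_dd_nonneg[OF f]) auto
    have new: "a \<notin> ?C" "a + x \<notin> ?C" "a \<noteq> a + x"
      using False x by (auto simp: nodes_Suc_shift) (auto simp: nodes_def)
    from dd_recursion[OF finite_nodes this, of f]
    have "x * ?D = dd f (insert (a + x) ?C) - dd f (nodes a (Suc p))"
      by (simp add: nodes_Suc_shift insert_commute)
    also have "\<dots> \<le> ?d / fact p"
    proof -
      have "dd f (insert (a + x) ?C) \<le> (fwd_diff ^^ p) f (a + real N) / fact p"
        using new x N left_nodes by (intro upper) (auto simp: nodes_Suc_shift)
      then show ?thesis by (simp add: dd_nodes diff_divide_distrib)
    qed
    also have "\<dots> \<le> ?d"
      using d by (simp add: divide_le_eq mult_le_cancel_left1 fact_ge_1)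
    finally have xD: "x * ?D \<le> ?d" .
    have prod: "(\<Prod>i<p. \<bar>x - real (Suc i)\<bar>) \<le> real N ^ p"
    proof -
      have "(\<Prod>i<p. \<bar>x - real (Suc i)\<bar>) \<le> (\<Prod>i<p. real N)"
        using x N by (intro prod_mono) auto
      then show ?thesis by simp
    qed
    have "rho (Suc p) a f x = (\<Prod>i<p. x - real (Suc i)) * (x * ?D)"
      unfolding rho_eq_dd[OF False] by (simp add: prod.lessThan_Suc_shift del: prod.lessThan_Suc)
    then have "\<bar>rho (Suc p) a f x\<bar> = (\<Prod>i<p. \<bar>x - real (Suc i)\<bar>) * (x * ?D)"
      using x D by (simp add: abs_mult abs_prod)
    also have "\<dots> \<le> real N ^ p * ?d"
      using prod xD x D by (intro mult_mono) auto
    finally show ?thesis .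
  qed
qed

lemma fwd_diff_pow_uminus: "(fwd_diff ^^ p) (\<lambda>x. - f x) = (\<lambda>x. - (fwd_diff ^^ p) f x)"
  by (induction p) (auto simp: fwd_diff_def)

lemma p_concave_on_uminus: "p_concave_on p I f \<Longrightarrow> p_convex_on p I (\<lambda>x. - f x)"
  by (simp add: p_concave_on_def p_convex_on_def divided_diff_def sum_negf)

lemma rho_bound:
  assumes f: "p_convex_on (int p) {A..} f \<or> p_concave_on (int p) {A..} f" and a: "A \<le> a"
    and x: "0 < x" "x < real N" and N: "p < N"
  shows "\<bar>rho (Suc p) a f x\<bar> \<le> real N ^ p * \<bar>(fwd_diff ^^ p) f (a + real N) - (fwd_diff ^^ p) f a\<bar>"
  using f
proof
  assume "p_convex_on (int p) {A..} f"
  from rho_bound_convex[OF this a x N] show ?thesis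
    by (rule order_trans) (simp add: mult_left_mono)
next
  assume "p_concave_on (int p) {A..} f"
  from rho_bound_convex[OF p_concave_on_uminus[OF this] a x N]
  have "\<bar>rho (Suc p) a (\<lambda>x. - f x) x\<bar>
      \<le> real N ^ p * ((fwd_diff ^^ p) f a - (fwd_diff ^^ p) f (a + real N))"
    by (simp add: fwd_diff_pow_uminus)
  moreover have "rho (Suc p) a (\<lambda>x. - f x) x = - rho (Suc p) a f x"
    by (simp add: rho_def fwd_diff_pow_uminus sum_negf del: sum.lessThan_Suc)
  moreover have "real N ^ p * ((fwd_diff ^^ p) f a - (fwd_diff ^^ p) f (a + real N))
      \<le> real N ^ p * \<bar>(fwd_diff ^^ p) f (a + real N) - (fwd_diff ^^ p) f a\<bar>"
    by (intro mult_left_mono) auto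
  ultimately show ?thesis by linarith
qed

section \<open>The difference equation\<close>

lemma fwd_diff_pow_solution:
  assumes "\<forall>x>0. fwd_diff f x = g x" "0 < a"
  shows "(fwd_diff ^^ Suc n) f a = (fwd_diff ^^ n) g a"
  using assms(2)
proof (induction n arbitrary: a)
  case 0
  then show ?case using assms(1) by simp
next
  case (Suc n)
  have "(fwd_diff ^^ Suc (Suc n)) f a = (fwd_diff ^^ Suc n) f (a + 1) - (fwd_diff ^^ Suc n) f a"
    by (rule fwd_diff_pow_Suc)
  also have "\<dots> = (fwd_diff ^^ n) g (a + 1) - (fwd_diff ^^ n) g a"
    using Suc by simp
  finally show ?case by (simp only: fwd_diff_pow_Suc[of n])
qed

lemma sum_fwd_diff: "(\<Sum>k<N. fwd_diff h (a + real k)) = h (a + real N) - h a"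
  by (induction N) (auto simp: fwd_diff_def algebra_simps)

text \<open>
  The sum in \<open>f_seq\<close> telescopes. What is left beyond \<open>f x - f 1\<close> is minus the Newton remainder at
  \<open>n\<close>, since the differences of \<open>g\<close> in its last sum are those of \<open>f\<close> of one order higher.
\<close>

lemma f_seq_eq_rho:
  assumes f: "\<forall>x>0. fwd_diff f x = g x" and x: "0 < x" and n: "0 < n"
  shows "f_seq p n g x = f x - f 1 - rho (Suc p) (real n) f x"
proof -
  have tele: "(\<Sum>k=1..<n. g (real k) - g (x + real k))
      = (f (real n) - f 1) - (f (x + real n) - f (x + 1))"
    using n
  proof (induction n rule: nat_induct_non_zero)
    case 1
    then show ?case by simp
  next
    case (Suc n)
    have "g (real n) = f (real n + 1) - f (real n)"
      "g (x + real n) = f (x + real n + 1) - f (x + real n)"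
      using f x Suc.hyps by (auto simp: fwd_diff_def[symmetric])
    then show ?case using Suc by (simp add: algebra_simps)
  qed
  have "rho (Suc p) (real n) f x = f (x + real n) - f (real n)
      - (\<Sum>j<p. (x gchoose Suc j) * (fwd_diff ^^ Suc j) f (real n))"
    by (simp add: rho_def sum.lessThan_Suc_shift del: sum.lessThan_Suc funpow.simps)
  also have "(\<Sum>j<p. (x gchoose Suc j) * (fwd_diff ^^ Suc j) f (real n))
      = (\<Sum>j=1..p. (x gchoose j) * (fwd_diff ^^ (j - 1)) g (real n))"
    using n by (simp add: fwd_diff_pow_solution[OF f] sum.atLeast1_atMost_eq del: funpow.simps)
  finally have "rho (Suc p) (real n) f x = f (x + real n) - f (real n)
      - (\<Sum>j=1..p. (x gchoose j) * (fwd_diff ^^ (j - 1)) g (real n))" .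
  moreover have "g x = f (x + 1) - f x" using f x by (auto simp: fwd_diff_def[symmetric])
  ultimately show ?thesis unfolding f_seq_def tele by linarith
qed

section \<open>Limits along the naturals and the reals\<close>

lemma filterlim_add_nat_at_top_in:
  assumes "S \<in> {\<nat>, \<real>}"
  shows "filterlim (\<lambda>a. a + real k) (at_top_in S) (at_top_in S)"
proof -
  have "filterlim (\<lambda>a. a + real k) at_top (at_top :: real filter)"
    by (subst add.commute) (intro filterlim_tendsto_add_at_top[OF tendsto_const] filterlim_ident)
  moreover have "a + real k \<in> S" if "a \<in> S" for a
    using assms that by (auto simp: Reals_def)
  ultimately show ?thesis
    unfolding at_top_in_def
    by (auto simp: filterlim_inf filterlim_principal eventually_inf_principal
        intro: filterlim_mono)
qed

lemma filterlim_real_at_top_in: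
  assumes "S \<in> {\<nat>, \<real>}"
  shows "filterlim real (at_top_in S) sequentially"
  using assms filterlim_real_sequentially
  by (auto simp: at_top_in_def filterlim_inf filterlim_principal)

lemma eventually_ge_at_top_in: "eventually (\<lambda>a. c \<le> a) (at_top_in S)"
  using eventually_ge_at_top[of c]
  unfolding at_top_in_def eventually_inf_principal by (rule eventually_mono) simp

text \<open>
  Over an integer distance \<open>N\<close>, the increment of \<open>\<Delta>\<^sup>p f\<close> telescopes into \<open>N\<close> values of
  \<open>\<Delta>\<^sup>p g\<close>, at points that lie in \<open>S\<close> together with \<open>a\<close>. This holds for both choices of \<open>S\<close>, as each
  is closed under adding a natural number.
\<close>

lemma increment_tendsto_0:
  assumes S: "S \<in> {\<nat>, \<real>}" and g: "g \<in> D_class p S" and f: "\<forall>x>0. fwd_diff f x = g x"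
  shows "((\<lambda>a. (fwd_diff ^^ p) f (a + real N) - (fwd_diff ^^ p) f a) \<longlongrightarrow> 0) (at_top_in S)"
proof -
  have "((fwd_diff ^^ p) g \<longlongrightarrow> 0) (at_top_in S)" using g by (simp add: D_class_def)
  then have "((\<lambda>a. (fwd_diff ^^ p) g (a + real k)) \<longlongrightarrow> 0) (at_top_in S)" for k
    using filterlim_compose filterlim_add_nat_at_top_in[OF S] by blast
  then have "((\<lambda>a. \<Sum>k<N. (fwd_diff ^^ p) g (a + real k)) \<longlongrightarrow> 0) (at_top_in S)"
    by (intro tendsto_null_sum)
  moreover have "eventually (\<lambda>a. (\<Sum>k<N. (fwd_diff ^^ p) g (a + real k))
      = (fwd_diff ^^ p) f (a + real N) - (fwd_diff ^^ p) f a) (at_top_in S)"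
    using eventually_ge_at_top_in[of 1]
  proof eventually_elim
    case (elim a)
    have "(fwd_diff ^^ p) g (a + real k) = fwd_diff ((fwd_diff ^^ p) f) (a + real k)" for k
      using fwd_diff_pow_solution[OF f, of "a + real k" p] elim by simp
    then show ?case by (simp add: sum_fwd_diff)
  qed
  ultimately show ?thesis by (rule Lim_transform_eventually)
qed

lemma rho_uniform_limit:
  assumes S: "S \<in> {\<nat>, \<real>}" and g: "g \<in> D_class p S" and f: "\<forall>x>0. fwd_diff f x = g x"
    and K: "f \<in> K_class (int p)" and B: "bounded B" "B \<subseteq> {0<..}"
  shows "uniform_limit B (\<lambda>a. rho (Suc p) a f) (\<lambda>_. 0) (at_top_in S)"
proof -
  obtain A where A: "p_convex_on (int p) {A..} f \<or> p_concave_on (int p) {A..} f"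
    using K by (auto simp: K_class_def)
  obtain b where b: "\<And>x. x \<in> B \<Longrightarrow> \<bar>x\<bar> \<le> b"
    using B by (auto simp: bounded_iff)
  obtain N where N: "real N > max b (real p)" using reals_Archimedean2 by blast
  let ?u = "\<lambda>a. real N ^ p * \<bar>(fwd_diff ^^ p) f (a + real N) - (fwd_diff ^^ p) f a\<bar>"
  have u: "(?u \<longlongrightarrow> 0) (at_top_in S)"
    using increment_tendsto_0[OF S g f] by (intro tendsto_mult_right_zero tendsto_rabs_zero)
  show ?thesis
  proof (rule uniform_limitI)
    fix e :: real
    assume "0 < e"
    then have "eventually (\<lambda>a. ?u a < e) (at_top_in S)"
      using u by (rule order_tendstoD(2)[rotated])
    then show "eventually (\<lambda>a. \<forall>x\<in>B. dist (rho (Suc p) a f x) 0 < e) (at_top_in S)"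
      using eventually_ge_at_top_in[of A]
    proof eventually_elim
      case (elim a)
      show ?case
      proof
        fix x assume "x \<in> B"
        then have "0 < x" "x < real N" "p < N" using b[of x] B N by auto
        from rho_bound[OF A elim(2) this] elim(1)
        show "dist (rho (Suc p) a f x) 0 < e" by simp
      qed
    qed
  qed
qed

theorem theorem3p1:
  fixes S :: "real set" and p :: nat and f g :: "real \<Rightarrow> real"
  assumes S: "S \<in> {\<nat>, \<real>}"
    and g: "g \<in> D_class p S"
    and f_eq: "\<forall>x>0. fwd_diff f x = g x"
    and f_K: "f \<in> K_class (int p)"
  shows "f \<in> R_class (p + 1) S
    \<and> (\<forall>x>0. convergent (\<lambda>n. f_seq p n g x) \<and> f x = f 1 + lim (\<lambda>n. f_seq p n g x))
    \<and> (\<forall>B. bounded B \<and> B \<subseteq> {0<..} \<longrightarrow>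
          uniform_limit B (\<lambda>n. f_seq p n g) (\<lambda>x. f x - f 1) sequentially)"
proof (intro conjI)
  note rho = rho_uniform_limit[OF S g f_eq f_K]
  show "f \<in> R_class (p + 1) S"
    unfolding R_class_def
  proof (intro CollectI allI impI)
    fix x :: real
    assume "0 < x"
    with rho[of "{x}"] have "uniform_limit {x} (\<lambda>a. rho (Suc p) a f) (\<lambda>_. 0) (at_top_in S)"
      by simp
    then show "((\<lambda>a. rho (p + 1) a f x) \<longlongrightarrow> 0) (at_top_in S)" by simp
  qed
  show unif: "\<forall>B. bounded B \<and> B \<subseteq> {0<..} \<longrightarrow>
      uniform_limit B (\<lambda>n. f_seq p n g) (\<lambda>x. f x - f 1) sequentially"
  proof (intro allI impI uniform_limitI)
    fix B :: "real set" and e :: real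
    assume B: "bounded B \<and> B \<subseteq> {0<..}" and e: "0 < e"
    have "eventually (\<lambda>a. \<forall>x\<in>B. dist (rho (Suc p) a f x) 0 < e) (at_top_in S)"
      using uniform_limitD[OF rho e] B by blast
    then have "eventually (\<lambda>n. \<forall>x\<in>B. dist (rho (Suc p) (real n) f x) 0 < e) sequentially"
      using filterlim_real_at_top_in[OF S] by (rule eventually_compose_filterlim)
    then show "eventually (\<lambda>n. \<forall>x\<in>B. dist (f_seq p n g x) (f x - f 1) < e) sequentially"
      using eventually_gt_at_top[of 0]
    proof eventually_elim
      case (elim n)
      then show ?case
        using B by (auto simp: f_seq_eq_rho[OF f_eq] dist_real_def)
    qed
  qed
  show "\<forall>x>0. convergent (\<lambda>n. f_seq p n g x) \<and> f x = f 1 + lim (\<lambda>n. f_seq p n g x)"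
  proof (intro allI impI)
    fix x :: real
    assume "0 < x"
    with unif[rule_format, of "{x}"] have "uniform_limit {x} (\<lambda>n. f_seq p n g) (\<lambda>x. f x - f 1) sequentially"
      by simp
    then have "(\<lambda>n. f_seq p n g x) \<longlonglongrightarrow> f x - f 1"
      by simp
    then show "convergent (\<lambda>n. f_seq p n g x) \<and> f x = f 1 + lim (\<lambda>n. f_seq p n g x)"
      by (auto simp: convergent_def limI)
  qed
qed

end
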